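(* Let $m,n\ge 2$ be integers and suppose that $\mathcal{T}=(t_{i_1\ldots i_m})\in\mathbb{T}(\mathbb{C}^n,m)$ is a triangular tensor with nonzero diagonal elements, i.e. $t_{i\ldots i}\ne 0$ for all $i=1,\ldots,n$. Then for every $\mathbf{b}\in\mathbb{C}^n$, every $A\in\mathbb{T}(\mathbb{C}^n,2)$ and all $\mathcal{B}^j\in\mathbb{T}(\mathbb{C}^n,j)$, $j=3,\ldots,m-1$, the system $$\mathcal{T}\mathbf{x}^{m-1}=\mathcal{B}^{m-1}\mathbf{x}^{m-2}+\cdots+\mathcal{B}^3\mathbf{x}^2+A\mathbf{x}+\mathbf{b}$$ has a solution $\mathbf{x}\in\mathbb{C}^n$. (Only terms of degree at most $m-2$ occur on the right-hand side: for $m=3$ it is $A\mathbf{x}+\mathbf{b}$, and for $m=2$ it is $\mathbf{b}$.)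
   Context: $\mathbb{T}(\mathbb{C}^n,m)$ is the space of $m$-th order $n$-dimensional complex tensors $\mathcal{T}=(t_{i_1\ldots i_m})$, $1\le i_1,\ldots,i_m\le n$. For $\mathbf{x}\in\mathbb{C}^n$, $\mathcal{T}\mathbf{x}^{m-1}\in\mathbb{C}^n$ is the vector with $i$-th entry $\sum_{i_2,\ldots,i_m=1}^n t_{ii_2\ldots i_m}x_{i_2}\cdots x_{i_m}$; similarly $\mathcal{B}^j\mathbf{x}^{j-1}$. $\mathcal{T}$ is upper triangular if $t_{i_1\ldots i_m}=0$ whenever $\min\{i_2,\ldots,i_m\}<i_1$; lower triangular if $t_{i_1\ldots i_m}=0$ whenever $\max\{i_2,\ldots,i_m\}>i_1$; triangular if it is upper or lower triangular. *)

theory Defs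
  imports "HOL-Analysis.Analysis"
begin

text \<open>
  The index set $\{1,\dots,n\}$ is a finite linearly ordered type \<open>'n\<close> with \<open>CARD('n) = n\<close>.
  A tensor of order \<open>m\<close> is a function on multi-indices $(i_1,\dots,i_m)$, represented as lists
  of length \<open>m\<close>; it is normalised to \<open>0\<close> on all other lists, so that tensors are determined by
  their entries.
\<close>

definition tensors :: "nat \<Rightarrow> ('n::finite list \<Rightarrow> complex) set" where
  "tensors m = {T. \<forall>is. length is \<noteq> m \<longrightarrow> T is = 0}"

text \<open>\<open>tensor_apply m T x\<close> is the vector $T x^{m-1}$; the first argument is the order of \<open>T\<close>.\<close>

definition tensor_apply :: "nat \<Rightarrow> ('n::finite list \<Rightarrow> complex) \<Rightarrow> complex ^ 'n \<Rightarrow> complex ^ 'n" where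
  "tensor_apply m T x =
     (\<chi> i. \<Sum>is\<in>{is. length is = m - 1}. T (i # is) * (\<Prod>j\<leftarrow>is. x $ j))"

text \<open>The following two notions are only meaningful for order \<open>m \<ge> 2\<close>, where \<open>set is\<close> is nonempty.\<close>

definition upper_triangular_tensor :: "nat \<Rightarrow> ('n::{finite,linorder} list \<Rightarrow> complex) \<Rightarrow> bool" where
  "upper_triangular_tensor m T \<longleftrightarrow>
     (\<forall>i is. length is = m - 1 \<and> Min (set is) < i \<longrightarrow> T (i # is) = 0)"

definition lower_triangular_tensor :: "nat \<Rightarrow> ('n::{finite,linorder} list \<Rightarrow> complex) \<Rightarrow> bool" where
  "lower_triangular_tensor m T \<longleftrightarrow>
     (\<forall>i is. length is = m - 1 \<and> Max (set is) > i \<longrightarrow> T (i # is) = 0)"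

definition triangular_tensor :: "nat \<Rightarrow> ('n::{finite,linorder} list \<Rightarrow> complex) \<Rightarrow> bool" where
  "triangular_tensor m T \<longleftrightarrow> upper_triangular_tensor m T \<or> lower_triangular_tensor m T"

end

theory Submission
  imports Defs "HOL-Library.Multiset" "HOL-Computational_Algebra.Fundamental_Theorem_Algebra"
begin

text \<open>
  Give the variable $x_i$ the weight $d n + r_i$ with $d = m - 1$ and $0 \<le> r_i < n$, where the
  ranks $r$ follow or reverse the order of the indices according to the kind of triangularity.
  Then $x_i^d$ is strictly the heaviest monomial of the $i$-th equation. As these leading monomials
  involve pairwise different variables, the equations form a Groebner basis, so some linear
  functional on polynomials vanishes on the ideal they generate but not at $1$. The space of all
  functionals vanishing on the ideal is determined by the finitely many monomials with all
  exponents below $d$, and it is invariant under the commuting maps dual to multiplication by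
  $x_i$. The eigenvalues of a common eigenvector of these maps are the coordinates of a solution.
\<close>

section \<open>Linear dependence, and polynomials in a shift operator\<close>

lemma exists_linear_dependency:
  fixes v :: "'k \<Rightarrow> 'r \<Rightarrow> 'a::field"
  assumes "finite R" "finite K" "card R < card K"
  shows "\<exists>c. (\<exists>k\<in>K. c k \<noteq> 0) \<and> (\<forall>r\<in>R. (\<Sum>k\<in>K. c k * v k r) = 0)"
  using assms
proof (induction R arbitrary: K v rule: finite_induct)
  case empty
  then have "K \<noteq> {}" by auto
  then show ?case by (intro exI[of _ "\<lambda>_. 1"]) auto
next
  case (insert r R)
  show ?case
  proof (cases "\<forall>k\<in>K. v k r = 0")
    case True
    moreover obtain c where "\<exists>k\<in>K. c k \<noteq> 0" "\<forall>s\<in>R. (\<Sum>k\<in>K. c k * v k s) = 0"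
      using insert.IH[of K v] insert.prems insert.hyps by auto
    ultimately show ?thesis by (intro exI[of _ c]) auto
  next
    case False
    then obtain k0 where k0: "k0 \<in> K" "v k0 r \<noteq> 0" by auto
    \<comment> \<open>Gaussian elimination: with \<open>k0\<close> as pivot, \<open>v'\<close>
      clears coordinate \<open>r\<close> from the other vectors, leaving one vector and one
      coordinate fewer.\<close>
    define K' where "K' = K - {k0}"
    define v' where "v' k s = v k s - v k r / v k0 r * v k0 s" for k s
    have K': "finite K'" "k0 \<notin> K'" "K = insert k0 K'"
      using insert.prems k0 by (auto simp: K'_def)
    have "card R < card K'"
      using insert.prems insert.hyps K' by simp
    then obtain c where c: "\<exists>k\<in>K'. c k \<noteq> 0" "\<And>s. s \<in> R \<Longrightarrow> (\<Sum>k\<in>K'. c k * v' k s) = 0"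
      using insert.IH[of K' v'] K' by metis
    define c' where "c' = c(k0 := - (\<Sum>k\<in>K'. c k * v k r) / v k0 r)"
    have sum_c': "(\<Sum>k\<in>K. c' k * v k s) = c' k0 * v k0 s + (\<Sum>k\<in>K'. c k * v k s)" for s
      using K' by (auto simp: c'_def intro!: sum.cong)
    have "(\<Sum>k\<in>K. c' k * v k s) = 0" if "s \<in> insert r R" for s
    proof (cases "s = r")
      case True
      then show ?thesis unfolding sum_c' using k0 by (simp add: c'_def)
    next
      case False
      have "(\<Sum>k\<in>K'. c k * v' k s)
          = (\<Sum>k\<in>K'. c k * v k s) - (\<Sum>k\<in>K'. c k * v k r) / v k0 r * v k0 s"
        by (simp add: v'_def right_diff_distrib sum_subtractf sum_distrib_right sum_divide_distrib
            mult.assoc)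
      with False that c(2)[of s] show ?thesis
        unfolding sum_c' by (simp add: c'_def)
    qed
    moreover have "\<exists>k\<in>K. c' k \<noteq> 0"
      using c(1) K' by (auto simp: c'_def)
    ultimately show ?thesis by blast
  qed
qed

text \<open>This is p(S)L, where S is dual to multiplication by x_i: the value of \<open>L\<close>
  on p(x_i) times the monomial \<open>M\<close>.\<close>

definition poly_shift :: "'n \<Rightarrow> complex poly \<Rightarrow> ('n multiset \<Rightarrow> complex) \<Rightarrow> 'n multiset \<Rightarrow> complex" where
  "poly_shift i p L M = (\<Sum>k\<le>degree p. coeff p k * L (M + replicate_mset k i))"

lemma poly_shift_bound:
  assumes "degree p \<le> N"
  shows "poly_shift i p L M = (\<Sum>k\<le>N. coeff p k * L (M + replicate_mset k i))"
  unfolding poly_shift_def using assms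
  by (intro sum.mono_neutral_left) (auto simp: coeff_eq_0)

text \<open>This is p(S) = (S - a) q(S) for p = (X - a) q. If p(S)L = 0, then q(S)L is zero or an
  eigenvector of S.\<close>

lemma poly_shift_linear_factor:
  "poly_shift i ([:-a, 1:] * q) L M = poly_shift i q L (add_mset i M) - a * poly_shift i q L M"
proof -
  define N where "N = degree q"
  have "degree ([:-a, 1:] * q) \<le> Suc N"
    using degree_mult_le[of "[:-a, 1:]" q] by (simp add: N_def)
  then have "poly_shift i ([:-a, 1:] * q) L M
      = (\<Sum>k\<le>Suc N. coeff ([:-a, 1:] * q) k * L (M + replicate_mset k i))"
    by (rule poly_shift_bound)
  also have "\<dots> = (\<Sum>k\<le>Suc N. coeff (pCons 0 q) k * L (M + replicate_mset k i))
      - (\<Sum>k\<le>Suc N. a * (coeff q k * L (M + replicate_mset k i)))"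
    by (simp add: sum_subtractf[symmetric] algebra_simps del: sum.atMost_Suc)
  also have "(\<Sum>k\<le>Suc N. a * (coeff q k * L (M + replicate_mset k i))) = a * poly_shift i q L M"
    by (subst poly_shift_bound[of q "Suc N"]) (simp_all add: N_def sum_distrib_left del: sum.atMost_Suc)
  also have "(\<Sum>k\<le>Suc N. coeff (pCons 0 q) k * L (M + replicate_mset k i))
      = poly_shift i q L (add_mset i M)"
    by (subst sum.atMost_Suc_shift) (simp add: poly_shift_def N_def)
  finally show ?thesis .
qed

section \<open>Functionals vanishing on the ideal of the system\<close>

text \<open>
  A monomial in variables indexed by \<open>'n\<close> is a multiset. The functionals in \<open>annihilators\<close>
  are those on polynomials that vanish on the ideal generated by
  $x_i^d - \sum_{k \in K_i} g_{ik} x^{\mu_k}$.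
\<close>

locale dominated_system =
  fixes d :: nat
    and w :: "'n::finite \<Rightarrow> nat"
    and K :: "'n \<Rightarrow> 'k set"
    and g :: "'n \<Rightarrow> 'k \<Rightarrow> complex"
    and \<mu> :: "'k \<Rightarrow> 'n multiset"
  assumes d_pos: "0 < d"
    and weight_less: "k \<in> K i \<Longrightarrow> sum_mset (image_mset w (\<mu> k)) < d * w i"
begin

abbreviation weight :: "'n multiset \<Rightarrow> nat" where
  "weight M \<equiv> sum_mset (image_mset w M)"

definition annihilators :: "('n multiset \<Rightarrow> complex) set" where
  "annihilators = {L. \<forall>M i. L (M + replicate_mset d i) = (\<Sum>k\<in>K i. g i k * L (M + \<mu> k))}"

lemma annihilatorsD:
  "L \<in> annihilators \<Longrightarrow> L (M + replicate_mset d i) = (\<Sum>k\<in>K i. g i k * L (M + \<mu> k))"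
  by (simp add: annihilators_def)

lemma weight_replace:
  assumes "k \<in> K i" "d \<le> count M i"
  shows "weight (M - replicate_mset d i + \<mu> k) < weight M"
proof -
  have "replicate_mset d i \<subseteq># M"
    using assms(2) by (simp add: count_le_replicate_mset_subset_eq)
  then obtain N where "M = replicate_mset d i + N"
    by (metis subset_mset.add_diff_inverse)
  with weight_less[OF assms(1)] show ?thesis by simp
qed

text \<open>The constant coefficient of the normal form of a monomial when each x_i^d is rewritten
  by its right-hand side. The value 1 at the empty monomial keeps the functional from being
  zero.\<close>

function normal_form_functional :: "'n multiset \<Rightarrow> complex" where
  "normal_form_functional M =
     (if \<exists>i. d \<le> count M i
      then let i = (SOME i. d \<le> count M i)
           in \<Sum>k\<in>K i. g i k * normal_form_functional (M - replicate_mset d i + \<mu> k)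
      else if M = {#} then 1 else 0)"
  by auto
termination
proof (relation "Wellfounded.measure weight")
  fix M :: "'n multiset" and i k
  assume *: "\<exists>i. d \<le> count M i" "i = (SOME i. d \<le> count M i)" "k \<in> K i"
  have "d \<le> count M i"
    unfolding *(2) using *(1) by (rule someI_ex)
  from weight_replace[OF *(3) this]
  show "(M - replicate_mset d i + \<mu> k, M) \<in> Wellfounded.measure weight"
    unfolding in_measure .
qed simp

declare normal_form_functional.simps [simp del]

lemma normal_form_functional_empty: "normal_form_functional {#} = 1"
  using d_pos by (simp add: normal_form_functional.simps)

text \<open>
  The recursion rewrites one chosen power; a different choice gives the same value because two
  rewritings of different variables commute.
\<close>

lemma normal_form_functional_rewrite:
  "d \<le> count M i \<Longrightarrow> normal_form_functional M
     = (\<Sum>k\<in>K i. g i k * normal_form_functional (M - replicate_mset d i + \<mu> k))"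
proof (induction "weight M" arbitrary: M i rule: less_induct)
  case less
  define j where "j = (SOME j. d \<le> count M j)"
  have j: "d \<le> count M j"
    unfolding j_def using less.prems by (rule someI)
  have rec: "normal_form_functional M
      = (\<Sum>k\<in>K j. g j k * normal_form_functional (M - replicate_mset d j + \<mu> k))"
    using less.prems by (subst normal_form_functional.simps) (auto simp: j_def Let_def)
  show ?case
  proof (cases "i = j")
    case True
    with rec show ?thesis by simp
  next
    case False
    \<comment> \<open>As \<open>a \<noteq> b\<close>, rewriting a power of \<open>a\<close> leaves
      the exponent of \<open>b\<close> at least \<open>d\<close>; the weight has dropped, so the
      induction hypothesis can rewrite \<open>b\<close> next.\<close>
    have expand: "normal_form_functional (M - replicate_mset d a + \<mu> k)
        = (\<Sum>l\<in>K b. g b l *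
             normal_form_functional (M - replicate_mset d a - replicate_mset d b + \<mu> k + \<mu> l))"
      if "k \<in> K a" "d \<le> count M a" "d \<le> count M b" "a \<noteq> b" for a b k
    proof -
      have sub: "replicate_mset d b \<subseteq># M - replicate_mset d a"
        using that by (simp add: count_le_replicate_mset_subset_eq[symmetric])
      have "d \<le> count (M - replicate_mset d a + \<mu> k) b"
        using that by simp
      from less.hyps[OF weight_replace[OF that(1,2)] this]
      show ?thesis
        by (simp only: subset_mset.add_diff_assoc2[OF sub])
    qed
    have "normal_form_functional M
        = (\<Sum>k\<in>K j. \<Sum>l\<in>K i. g j k * (g i l *
             normal_form_functional (M - replicate_mset d j - replicate_mset d i + \<mu> k + \<mu> l)))"
      unfolding rec using expand j less.prems False by (simp add: sum_distrib_left)
    also have "\<dots> = (\<Sum>l\<in>K i. \<Sum>k\<in>K j. g j k * (g i l *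
             normal_form_functional (M - replicate_mset d j - replicate_mset d i + \<mu> k + \<mu> l)))"
      by (rule sum.swap)
    also have "\<dots> = (\<Sum>l\<in>K i. \<Sum>k\<in>K j. g i l * (g j k *
             normal_form_functional (M - replicate_mset d i - replicate_mset d j + \<mu> l + \<mu> k)))"
      by (intro sum.cong refl) (simp add: ac_simps diff_right_commute)
    also have "\<dots> = (\<Sum>l\<in>K i. g i l * normal_form_functional (M - replicate_mset d i + \<mu> l))"
      using expand j less.prems False by (simp add: sum_distrib_left)
    finally show ?thesis .
  qed
qed

lemma normal_form_functional_annihilator: "normal_form_functional \<in> annihilators"
  unfolding annihilators_def
proof (intro CollectI allI)
  fix M i
  show "normal_form_functional (M + replicate_mset d i)
      = (\<Sum>k\<in>K i. g i k * normal_form_functional (M + \<mu> k))"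
    using normal_form_functional_rewrite[of "M + replicate_mset d i" i] by simp
qed

text \<open>An unreduced monomial takes its value from lighter ones, so induction on the weight
  spreads vanishing from the reduced monomials to all.\<close>

lemma annihilator_eq_0:
  assumes "L \<in> annihilators" "\<And>M. (\<forall>i. count M i < d) \<Longrightarrow> L M = 0"
  shows "L M = 0"
proof (induction "weight M" arbitrary: M rule: less_induct)
  case less
  show ?case
  proof (cases "\<forall>i. count M i < d")
    case False
    then obtain i where i: "d \<le> count M i" by (auto simp: not_less)
    then have "M = (M - replicate_mset d i) + replicate_mset d i"
      by (simp add: count_le_replicate_mset_subset_eq)
    then have "L M = (\<Sum>k\<in>K i. g i k * L (M - replicate_mset d i + \<mu> k))"
      using annihilatorsD[OF assms(1)] by metis
    also have "\<dots> = 0"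
      using less weight_replace i by (intro sum.neutral) auto
    finally show ?thesis .
  qed (use assms in auto)
qed

lemma finite_reduced_monomials: "finite {M :: 'n multiset. \<forall>i. count M i < d}"
proof (rule finite_imageD)
  have "count ` {M :: 'n multiset. \<forall>i. count M i < d} \<subseteq> (UNIV :: 'n set) \<rightarrow>\<^sub>E {..<d}"
    by auto
  then show "finite (count ` {M :: 'n multiset. \<forall>i. count M i < d})"
    by (rule finite_subset) (simp add: finite_PiE)
  show "inj_on count {M :: 'n multiset. \<forall>i. count M i < d}"
    by (auto simp: inj_on_def count_inject)
qed

lemma poly_shift_annihilator:
  assumes "L \<in> annihilators"
  shows "poly_shift i p L \<in> annihilators"
proof -
  have "poly_shift i p L (M + replicate_mset d j) = (\<Sum>k\<in>K j. g j k * poly_shift i p L (M + \<mu> k))"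
    for M j
  proof -
    have "poly_shift i p L (M + replicate_mset d j)
        = (\<Sum>l\<le>degree p. coeff p l * L ((M + replicate_mset l i) + replicate_mset d j))"
      by (simp add: poly_shift_def ac_simps)
    also have "\<dots> = (\<Sum>l\<le>degree p. \<Sum>k\<in>K j. g j k * (coeff p l * L (M + \<mu> k + replicate_mset l i)))"
      by (simp only: annihilatorsD[OF assms]) (simp add: sum_distrib_left ac_simps)
    also have "\<dots> = (\<Sum>k\<in>K j. g j k * poly_shift i p L (M + \<mu> k))"
      by (subst sum.swap) (simp add: poly_shift_def sum_distrib_left)
    finally show ?thesis .
  qed
  then show ?thesis by (simp add: annihilators_def)
qed

text \<open>Shifting \<open>L\<close> from 0 to \<open>card R\<close> times gives
  \<open>card R + 1\<close> functionals, which are dependent on the \<open>card R\<close> reduced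
  monomials. The combination is again an annihilator, so it vanishes everywhere.\<close>

lemma exists_poly_shift_eq_0:
  assumes "L \<in> annihilators"
  shows "\<exists>p. p \<noteq> 0 \<and> poly_shift i p L = (\<lambda>_. 0)"
proof -
  define R where "R = {M :: 'n multiset. \<forall>i. count M i < d}"
  obtain c where c: "\<exists>k\<in>{..card R}. c k \<noteq> 0"
    "\<forall>M\<in>R. (\<Sum>k\<le>card R. c k * L (M + replicate_mset k i)) = 0"
    using exists_linear_dependency[of R "{..card R}" "\<lambda>k M. L (M + replicate_mset k i)"]
      finite_reduced_monomials by (auto simp: R_def)
  define p where "p = (\<Sum>k\<le>card R. monom (c k) k)"
  have coeff_p: "coeff p k = (if k \<le> card R then c k else 0)" for k
    by (simp add: p_def coeff_sum sum.delta')
  have "degree p \<le> card R"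
    by (rule degree_le) (simp add: coeff_p)
  then have "poly_shift i p L M = 0" if "M \<in> R" for M
    using c(2) that by (simp add: poly_shift_bound coeff_p)
  then have "poly_shift i p L M = 0" for M
    using annihilator_eq_0[OF poly_shift_annihilator[OF assms]] by (simp add: R_def)
  moreover have "p \<noteq> 0"
    using c(1) coeff_p by (metis atMost_iff coeff_0)
  ultimately show ?thesis by blast
qed

text \<open>Passing from \<open>L\<close> to \<open>poly_shift i q L\<close> keeps the eigenvalue equations already achieved.\<close>

lemma exists_joint_eigenfunctional:
  assumes "finite J"
  shows "\<exists>L\<in>annihilators. L \<noteq> (\<lambda>_. 0) \<and> (\<forall>i\<in>J. \<exists>a. \<forall>M. L (add_mset i M) = a * L M)"
  using assms
proof induction
  case empty
  have "normal_form_functional \<noteq> (\<lambda>_. 0)"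
    using normal_form_functional_empty by (metis zero_neq_one)
  then show ?case using normal_form_functional_annihilator by auto
next
  case (insert j J)
  then obtain L where L: "L \<in> annihilators" "L \<noteq> (\<lambda>_. 0)"
    and eig: "\<And>i. i \<in> J \<Longrightarrow> \<exists>a. \<forall>M. L (add_mset i M) = a * L M"
    by blast
  obtain p0 where "p0 \<noteq> 0 \<and> poly_shift j p0 L = (\<lambda>_. 0)"
    using exists_poly_shift_eq_0[OF L(1)] by blast
  \<comment> \<open>Least degree makes \<open>p\<close> a minimal polynomial for \<open>L\<close>:
    dividing out a root cannot give the zero functional.\<close>
  then obtain p where p: "p \<noteq> 0" "poly_shift j p L = (\<lambda>_. 0)"
    and min: "\<And>q. q \<noteq> 0 \<Longrightarrow> poly_shift j q L = (\<lambda>_. 0) \<Longrightarrow> degree p \<le> degree q"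
    using ex_has_least_nat[of "\<lambda>p. p \<noteq> 0 \<and> poly_shift j p L = (\<lambda>_. 0)" p0 degree] by blast
  have "degree p \<noteq> 0"
  proof
    assume deg: "degree p = 0"
    then have "coeff p 0 \<noteq> 0"
      using p(1) leading_coeff_0_iff by metis
    moreover have "coeff p 0 * L M = 0" for M
      using fun_cong[OF p(2), of M] deg by (simp add: poly_shift_def)
    ultimately show False using L(2) by auto
  qed
  then obtain a where "poly p a = 0"
    using fundamental_theorem_of_algebra[of p] by (auto simp: constant_degree)
  then obtain q where q: "p = [:-a, 1:] * q"
    by (auto simp: poly_eq_0_iff_dvd elim: dvdE)
  have "q \<noteq> 0" using p(1) q by auto
  then have "degree q < degree p"
    unfolding q by (subst degree_mult_eq) auto
  then have nz: "poly_shift j q L \<noteq> (\<lambda>_. 0)"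
    using min[OF \<open>q \<noteq> 0\<close>] by auto
  have "poly_shift j q L (add_mset j M) = a * poly_shift j q L M" for M
    using fun_cong[OF p(2), of M] unfolding q poly_shift_linear_factor by simp
  moreover have "\<exists>a. \<forall>M. poly_shift j q L (add_mset i M) = a * poly_shift j q L M" if "i \<in> J" for i
    using eig[OF that] by (force simp: poly_shift_def sum_distrib_left mult.left_commute)
  ultimately show ?case
    using nz poly_shift_annihilator[OF L(1)] by blast
qed

text \<open>A joint eigenfunctional is \<open>L {#}\<close> times evaluation at the point of its
  eigenvalues. The factor is nonzero, and the ideal relations at the empty monomial become the
  equations.\<close>

theorem solvable:
  "\<exists>x :: 'n \<Rightarrow> complex. \<forall>i. x i ^ d = (\<Sum>k\<in>K i. g i k * prod_mset (image_mset x (\<mu> k)))"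
proof -
  obtain L where L: "L \<in> annihilators" "L \<noteq> (\<lambda>_. 0)"
    "\<forall>i\<in>UNIV. \<exists>a. \<forall>M. L (add_mset i M) = a * L M"
    using exists_joint_eigenfunctional[OF finite] by blast
  then have "\<forall>i. \<exists>a. \<forall>M. L (add_mset i M) = a * L M"
    by simp
  then obtain x where x: "\<And>i M. L (add_mset i M) = x i * L M"
    by metis
  have LM: "L M = prod_mset (image_mset x M) * L {#}" for M
    by (induction M) (simp_all add: x)
  have nz: "L {#} \<noteq> 0"
  proof
    assume "L {#} = 0"
    then have "L M = 0" for M
      by (subst LM) simp
    with L(2) show False by blast
  qed
  have "x i ^ d * L {#} = (\<Sum>k\<in>K i. g i k * prod_mset (image_mset x (\<mu> k))) * L {#}" for i
    using annihilatorsD[OF L(1), of "{#}" i]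
    unfolding add_0 LM[of "replicate_mset d i"] LM[of "\<mu> _"]
    by (simp add: sum_distrib_right mult.assoc)
  with nz show ?thesis by auto
qed

end

section \<open>Ranks and weights for a triangular tensor\<close>

lemma sum_list_map_le:
  fixes f :: "'a \<Rightarrow> nat"
  assumes "\<And>x. x \<in> set xs \<Longrightarrow> f x \<le> c"
  shows "sum_list (map f xs) \<le> length xs * c"
  using assms by (induction xs) (auto intro: add_mono)

lemma sum_list_map_less:
  fixes f :: "'a \<Rightarrow> nat"
  assumes "\<And>x. x \<in> set xs \<Longrightarrow> f x \<le> c" "x \<in> set xs" "f x < c"
  shows "sum_list (map f xs) < length xs * c"
proof -
  obtain ys zs where xs: "xs = ys @ x # zs"
    using split_list[OF assms(2)] by blast
  have "sum_list (map f ys) \<le> length ys * c" "sum_list (map f zs) \<le> length zs * c"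
    using assms(1) xs by (auto intro!: sum_list_map_le)
  with assms(3) show ?thesis by (simp add: xs algebra_simps)
qed

text \<open>In the upper triangular case row \<open>i\<close> involves only indices from
  \<open>i\<close> on, so the rank counts the larger indices; in the lower case it counts the
  smaller ones.\<close>

lemma triangular_tensor_rank:
  fixes T :: "'n::{finite,linorder} list \<Rightarrow> complex"
  assumes "triangular_tensor m T"
  obtains r :: "'n \<Rightarrow> nat" where "inj r" "\<And>i. r i < CARD('n)"
    "\<And>i is j. length is = m - 1 \<Longrightarrow> T (i # is) \<noteq> 0 \<Longrightarrow> j \<in> set is \<Longrightarrow> r j \<le> r i"
proof (cases "upper_triangular_tensor m T")
  case True
  define r :: "'n \<Rightarrow> nat" where "r i = card {i<..}" for i
  have less: "r j < r i" if "i < j" for i j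
    unfolding r_def using that by (intro psubset_card_mono) auto
  show ?thesis
  proof (rule that)
    show "inj r"
      by (rule injI) (metis less less_irrefl linorder_neq_iff)
    show "r i < CARD('n)" for i
      unfolding r_def by (intro psubset_card_mono) auto
    show "r j \<le> r i" if "length is = m - 1" "T (i # is) \<noteq> 0" "j \<in> set is" for i "is" j
    proof -
      have "i \<le> Min (set is)"
        using True that(1,2) unfolding upper_triangular_tensor_def by (meson not_less)
      also have "\<dots> \<le> j" using that(3) by simp
      finally show ?thesis using less by (metis less_imp_le order_le_less)
    qed
  qed
next
  case False
  then have lower: "lower_triangular_tensor m T"
    using assms by (simp add: triangular_tensor_def)
  define r :: "'n \<Rightarrow> nat" where "r i = card {..<i}" for i
  have less: "r i < r j" if "i < j" for i j
    unfolding r_def using that by (intro psubset_card_mono) auto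
  show ?thesis
  proof (rule that)
    show "inj r"
      by (rule injI) (metis less less_irrefl linorder_neq_iff)
    show "r i < CARD('n)" for i
      unfolding r_def by (intro psubset_card_mono) auto
    show "r j \<le> r i" if "length is = m - 1" "T (i # is) \<noteq> 0" "j \<in> set is" for i "is" j
    proof -
      have "j \<le> Max (set is)" using that(3) by simp
      also have "\<dots> \<le> i"
        using lower that(1,2) unfolding lower_triangular_tensor_def by (meson not_less)
      finally show ?thesis using less by (metis less_imp_le order_le_less)
    qed
  qed
qed

section \<open>The tensor system as a dominated system\<close>

theorem theorem6p1:
  fixes m :: nat
    and T :: "'n::{finite,linorder} list \<Rightarrow> complex"
    and b :: "complex ^ 'n::{finite,linorder}"
    and A :: "complex ^ 'n::{finite,linorder} ^ 'n::{finite,linorder}"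
    and B :: "nat \<Rightarrow> 'n::{finite,linorder} list \<Rightarrow> complex"
  assumes "m \<ge> 2" and "CARD('n) \<ge> 2"
    and "T \<in> tensors m"
    and "triangular_tensor m T"
    and "\<forall>i. T (replicate m i) \<noteq> 0"
    and "\<forall>j\<in>{3..m - 1}. B j \<in> tensors j"
  shows "\<exists>x :: complex ^ 'n::{finite,linorder}.
           tensor_apply m T x =
             (\<Sum>j\<in>{3..m - 1}. tensor_apply j (B j) x) + (if m \<ge> 3 then A *v x else 0) + b"
proof -
  define d where "d = m - 1"
  have d: "0 < d" "m = Suc d" using assms(1) by (auto simp: d_def)
  define n where "n = CARD('n)"
  obtain r :: "'n \<Rightarrow> nat" where r: "inj r" "\<And>i. r i < n"
    "\<And>i is j. length is = d \<Longrightarrow> T (i # is) \<noteq> 0 \<Longrightarrow> j \<in> set is \<Longrightarrow> r j \<le> r i"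
    using triangular_tensor_rank[OF assms(4)] unfolding n_def d_def by blast
  \<comment> \<open>The offset \<open>d * n\<close> makes every monomial of degree below \<open>d\<close> lighter than every \<open>x i ^ d\<close>.\<close>
  define w where "w i = d * n + r i" for i
  define t where "t i = T (i # replicate d i)" for i
  have t: "t i \<noteq> 0" for i
    using assms(5) d(2) by (simp add: t_def)
  \<comment> \<open>All terms but \<open>t i * x i ^ d\<close> are moved to the right, hence the
    minus sign and the 0 on the diagonal. The test for length \<open>d\<close> comes first, so
    \<open>A\<close> drops out for \<open>d = 1\<close>.\<close>
  define G where "G i is =
    (if length is = d then (if is = replicate d i then 0 else - T (i # is))
     else if is = [] then b $ i
     else if length is = 1 then A $ i $ hd is
     else B (Suc (length is)) (i # is))" for i and "is" :: "'n list"
  \<comment> \<open>Lists with zero coefficient are left out, since their monomials, such as the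
    diagonal one, need not be lighter than x_i^d.\<close>
  define K where "K i = {is. length is \<le> d \<and> G i is \<noteq> 0}" for i
  have fin: "finite {is :: 'n list. length is \<le> l}" "finite {is :: 'n list. length is = l}" for l
    using finite_lists_length_le[of "UNIV :: 'n set" l] finite_lists_length_eq[of "UNIV :: 'n set" l]
    by auto
  \<comment> \<open>Different lists may give the same monomial, so terms are indexed by lists and
    \<open>mset\<close> supplies the monomial.\<close>
  interpret dominated_system d w K "\<lambda>i is. G i is / t i" mset
  proof
    show "0 < d" by (rule d(1))
    fix i :: 'n and "is" assume "is \<in> K i"
    then have len: "length is \<le> d" and nz: "G i is \<noteq> 0" by (auto simp: K_def)
    have "sum_list (map w is) < d * w i"
    proof (cases "length is = d")
      case True
      with nz have "is \<noteq> replicate d i" "T (i # is) \<noteq> 0" by (auto simp: G_def split: if_splits)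
      \<comment> \<open>Only the excluded constant list has all entries equal to \<open>i\<close>;
        for another entry \<open>j\<close>, injectivity of \<open>r\<close> makes
        \<open>r j \<le> r i\<close> strict.\<close>
      then obtain j where j: "j \<in> set is" "j \<noteq> i"
        using True by (metis replicate_eqI)
      have le: "r k \<le> r i" if "k \<in> set is" for k
        using r(3)[OF True \<open>T (i # is) \<noteq> 0\<close> that] .
      moreover have "r j < r i"
        using le[OF j(1)] j(2) injD[OF r(1)] by (metis le_neq_implies_less)
      ultimately show ?thesis
        using sum_list_map_less[of "is" w "w i" j] j(1) True by (simp add: w_def)
    next
      case False
      have "w j \<le> d * n + n" for j
        using r(2)[of j] by (simp add: w_def)
      then have "sum_list (map w is) \<le> length is * (d * n + n)"
        by (rule sum_list_map_le)
      also have "\<dots> \<le> (d - 1) * (d * n + n)"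
        using False len by (intro mult_right_mono) auto
      \<comment> \<open>The left side equals (d^2 - 1) n.\<close>
      also have "\<dots> < d * (d * n)"
      proof -
        obtain e where "d = Suc e" using d(1) by (cases d) auto
        moreover have "0 < n" by (simp add: n_def)
        ultimately show ?thesis by (simp add: algebra_simps)
      qed
      also have "\<dots> \<le> d * w i" by (simp add: w_def)
      finally show ?thesis .
    qed
    then show "sum_mset (image_mset w (mset is)) < d * w i"
      by (simp add: sum_mset_sum_list flip: mset_map)
  qed
  obtain f where f: "\<And>i. f i ^ d = (\<Sum>is\<in>K i. G i is / t i * prod_mset (image_mset f (mset is)))"
    using solvable by blast
  define x where "x = (\<chi> i. f i)"
  define P where "P i l = (\<Sum>is | length is = l. G i is * (\<Prod>j\<leftarrow>is. x $ j))" for i l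
  have component: "tensor_apply m T x $ i = (\<Sum>l<d. P i l)" for i
  proof -
    have "t i * x $ i ^ d = (\<Sum>is\<in>K i. G i is * (\<Prod>j\<leftarrow>is. x $ j))"
      using t[of i] by (simp add: x_def f sum_distrib_left prod_mset_prod_list flip: mset_map)
    also have "\<dots> = (\<Sum>is | length is \<le> d. G i is * (\<Prod>j\<leftarrow>is. x $ j))"
      by (intro sum.mono_neutral_left fin) (auto simp: K_def)
    also have "{is :: 'n list. length is \<le> d} = (\<Union>l\<le>d. {is. length is = l})"
      by auto
    also have "(\<Sum>is\<in>\<dots>. G i is * (\<Prod>j\<leftarrow>is. x $ j)) = (\<Sum>l\<le>d. P i l)"
      unfolding P_def by (intro sum.UNION_disjoint) (auto simp: fin)
    also have "\<dots> = (\<Sum>l<d. P i l) + P i d"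
      by (simp flip: lessThan_Suc_atMost)
    \<comment> \<open>In top degree \<open>G\<close> is \<open>-T\<close> without the diagonal
      entry, so \<open>t i * x $ i ^ d\<close> cancels and only the lower degrees remain.\<close>
    also have "P i d = t i * x $ i ^ d - tensor_apply m T x $ i"
    proof -
      have "P i d = (\<Sum>is | length is = d.
          (if is = replicate d i then t i * x $ i ^ d else 0) - T (i # is) * (\<Prod>j\<leftarrow>is. x $ j))"
        unfolding P_def by (intro sum.cong) (auto simp: G_def t_def)
      then show ?thesis
        by (simp add: sum_subtractf fin tensor_apply_def d)
    qed
    finally show ?thesis by simp
  qed
  have P0: "P i 0 = b $ i" for i
    using d by (simp add: P_def G_def)
  have P1: "P i (Suc 0) = (A *v x) $ i" if "1 < d" for i
  proof -
    have "{is :: 'n list. length is = Suc 0} = (\<lambda>j. [j]) ` UNIV"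
      by (auto simp: length_Suc_conv)
    then show ?thesis
      using that by (simp add: P_def G_def matrix_vector_mult_def sum.reindex inj_on_def)
  qed
  have P2: "P i l = tensor_apply (Suc l) (B (Suc l)) x $ i" if "2 \<le> l" "l < d" for i l
    using that unfolding P_def tensor_apply_def by (auto simp: G_def intro!: sum.cong)
  have "(\<Sum>l<d. P i l)
      = ((\<Sum>j\<in>{3..m - 1}. tensor_apply j (B j) x) + (if m \<ge> 3 then A *v x else 0) + b) $ i" for i
  proof (cases "d = 1")
    case True
    then show ?thesis using d P0 by simp
  next
    case False
    with d(1) have "1 < d" by simp
    then have "{..<d} = insert 0 (insert (Suc 0) {2..<d})" by auto
    then have "(\<Sum>l<d. P i l) = P i 0 + (P i (Suc 0) + (\<Sum>l\<in>{2..<d}. P i l))"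
      by simp
    \<comment> \<open>A tensor of order \<open>j\<close> contributes in degree
      \<open>j - 1\<close>.\<close>
    also have "(\<Sum>l\<in>{2..<d}. P i l) = (\<Sum>j\<in>{3..m - 1}. tensor_apply j (B j) x $ i)"
      using d by (intro sum.reindex_bij_witness[of _ "\<lambda>j. j - 1" Suc]) (auto simp: P2)
    finally show ?thesis
      using \<open>1 < d\<close> d by (simp add: P0 P1)
  qed
  with component show ?thesis by (metis vec_eq_iff)
qed

end
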